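(* Let $Y$ be a Banach space, let $\tau>0$, and let $W=(W^n)_{n\in\mathbb N}$ be a sequence in $Y$, extended by $W^n:=0$ for negative $n$. Set $t^n:=n\tau$ and $J_n:=[t^n,t^{n+1})$, and define $L(W):J\to Y$, $J:=[0,+\infty)$, by $$L(W)(t):=\alpha^n+\beta^n(t-t^n)+\gamma^n\tfrac12(t-t^n)^2+\vartheta^n\tfrac16(t-t^n)^3+\epsilon^n\tfrac1{24}(t-t^n)^4,\qquad t\in J_n,\ n\in\mathbb N,$$ with $$\alpha^n=\frac{3W^{n+1}+17W^n+5W^{n-1}-W^{n-2}}{24},\quad \beta^n=\frac{5W^{n+1}+3W^n-9W^{n-1}+W^{n-2}}{12\tau},\quad \gamma^n=\frac{W^{n+1}-2W^n+W^{n-1}}{\tau^2},$$ $$\vartheta^n=\frac{W^{n+2}-2W^{n+1}+2W^{n-1}-W^{n-2}}{2\tau^3},\quad \epsilon^n=\frac{W^{n+2}-4W^{n+1}+6W^n-4W^{n-1}+W^{n-2}}{\tau^4}.$$ Then $L(W)\in C^2(J;Y)$.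
   Context: $\mathbb N$ includes $0$. In the paper $Y$ is a Banach space composed of functions defined over a domain $\Omega$ (e.g. $L^2(\Omega)$, $H^1_0(\Omega)$ or a finite element space). *)

theory Defs
  imports "HOL-Analysis.Analysis"
begin

text \<open>
  \<open>C\<^sup>k(S; Y)\<close> for a set of reals \<open>S\<close>. Derivatives are relative to \<open>S\<close>, so at a boundary
  point that belongs to \<open>S\<close> they are one-sided. Intended for sets without isolated points,
  such as intervals, where these derivatives are unique.
\<close>

fun C_k_on :: "nat \<Rightarrow> real set \<Rightarrow> (real \<Rightarrow> 'a::real_normed_vector) \<Rightarrow> bool" where
  "C_k_on 0 S f \<longleftrightarrow> continuous_on S f"
| "C_k_on (Suc k) S f \<longleftrightarrow>
     (\<exists>f'. (\<forall>t\<in>S. (f has_vector_derivative f' t) (at t within S)) \<and> C_k_on k S f')"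

definition zero_ext :: "(nat \<Rightarrow> 'a::zero) \<Rightarrow> int \<Rightarrow> 'a" where
  "zero_ext W k = (if k < 0 then 0 else W (nat k))"

definition tnode :: "real \<Rightarrow> nat \<Rightarrow> real" where
  "tnode \<tau> n = real n * \<tau>"

definition J_cell :: "real \<Rightarrow> nat \<Rightarrow> real set" where
  "J_cell \<tau> n = {tnode \<tau> n ..< tnode \<tau> (Suc n)}"

context
  fixes \<tau> :: real and W :: "nat \<Rightarrow> 'a::real_normed_vector"
begin

definition coeff_alpha :: "nat \<Rightarrow> 'a" where
  "coeff_alpha n =
     (let w = (\<lambda>j. zero_ext W (int n + j)) in
       (3 *\<^sub>R w 1 + 17 *\<^sub>R w 0 + 5 *\<^sub>R w (-1) - w (-2)) /\<^sub>R 24)"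

definition coeff_beta :: "nat \<Rightarrow> 'a" where
  "coeff_beta n =
     (let w = (\<lambda>j. zero_ext W (int n + j)) in
       (5 *\<^sub>R w 1 + 3 *\<^sub>R w 0 - 9 *\<^sub>R w (-1) + w (-2)) /\<^sub>R (12 * \<tau>))"

definition coeff_gamma :: "nat \<Rightarrow> 'a" where
  "coeff_gamma n =
     (let w = (\<lambda>j. zero_ext W (int n + j)) in
       (w 1 - 2 *\<^sub>R w 0 + w (-1)) /\<^sub>R \<tau> ^ 2)"

definition coeff_theta :: "nat \<Rightarrow> 'a" where
  "coeff_theta n =
     (let w = (\<lambda>j. zero_ext W (int n + j)) in
       (w 2 - 2 *\<^sub>R w 1 + 2 *\<^sub>R w (-1) - w (-2)) /\<^sub>R (2 * \<tau> ^ 3))"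

definition coeff_epsilon :: "nat \<Rightarrow> 'a" where
  "coeff_epsilon n =
     (let w = (\<lambda>j. zero_ext W (int n + j)) in
       (w 2 - 4 *\<^sub>R w 1 + 6 *\<^sub>R w 0 - 4 *\<^sub>R w (-1) + w (-2)) /\<^sub>R \<tau> ^ 4)"

definition lift_poly :: "nat \<Rightarrow> real \<Rightarrow> 'a" where
  "lift_poly n t =
     coeff_alpha n
     + (t - tnode \<tau> n) *\<^sub>R coeff_beta n
     + ((t - tnode \<tau> n) ^ 2 / 2) *\<^sub>R coeff_gamma n
     + ((t - tnode \<tau> n) ^ 3 / 6) *\<^sub>R coeff_theta n
     + ((t - tnode \<tau> n) ^ 4 / 24) *\<^sub>R coeff_epsilon n"

text \<open>
  For \<open>\<tau> > 0\<close> the cells partition \<open>[0,\<infinity>)\<close>, so the description is proper for every \<open>t \<ge> 0\<close>;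
  values at negative \<open>t\<close> carry no meaning.
\<close>

definition lifting :: "real \<Rightarrow> 'a" where
  "lifting t = lift_poly (THE n. t \<in> J_cell \<tau> n) t"

end

lemma J_cell_iff_floor:
  assumes "\<tau> > 0"
  shows "t \<in> J_cell \<tau> n \<longleftrightarrow> \<lfloor>t / \<tau>\<rfloor> = int n"
  using assms by (simp add: J_cell_def tnode_def floor_eq_iff field_simps)

lemma Union_J_cell:
  assumes "\<tau> > 0"
  shows "(\<Union>n. J_cell \<tau> n) = {0..}"
proof -
  have "(\<exists>n. \<lfloor>t / \<tau>\<rfloor> = int n) \<longleftrightarrow> 0 \<le> t" for t
    using assms zero_le_floor[of "t / \<tau>"] zero_le_divide_iff[of t \<tau>]
    by (metis int_nat_eq less_le_not_le of_nat_0_le_iff)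
  then show ?thesis
    using J_cell_iff_floor[OF assms] by (simp add: set_eq_iff)
qed

lemma lifting_on_J_cell:
  assumes "\<tau> > 0" and "t \<in> J_cell \<tau> n"
  shows "lifting \<tau> W t = lift_poly \<tau> W n t"
proof -
  have "(THE m. t \<in> J_cell \<tau> m) = n"
    using assms by (intro the_equality) (auto simp: J_cell_iff_floor)
  then show ?thesis
    by (simp add: lifting_def)
qed

end

theory Submission
  imports Defs
begin

text \<open>
  Inside a cell \<open>L(W)\<close> is a quartic polynomial, so the only question is whether value, first
  and second derivative of consecutive quartics agree at the common node. This is an identity
  between five-point stencils. At the right end of cell \<open>n\<close>, value, first and second
  derivative of its quartic have, in the order \<open>W\<^sup>n\<^sup>+\<^sup>2, \<dots>, W\<^sup>n\<^sup>-\<^sup>2\<close>, the weights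
  \<open>(3, 17, 5, -1, 0) / 24\<close>, \<open>(5, 3, -9, 1, 0) / (12 \<tau>)\<close> and \<open>(1, -2, 1, 0, 0) / \<tau>\<^sup>2\<close>. The
  weight of \<open>W\<^sup>n\<^sup>-\<^sup>2\<close> vanishes, and what is left are the weights of
  \<open>\<alpha>\<close>, \<open>\<beta>\<close>, \<open>\<gamma>\<close> moved one step to the right, that is, the values at the left
  node of cell \<open>n + 1\<close> (lemma \<open>lift_deriv_match\<close>). Since \<open>W\<close> is extended by zero, this shift is
  valid also in the first cells, where negative indices occur. The third derivative does
  not match in this way, which is why the argument stops at order two.

  It remains to glue (lemma \<open>C_k_on_piecewise\<close>). Near any point of \<open>[0,\<infinity>)\<close> at most two
  closed cells matter, so limits along \<open>[0,\<infinity>)\<close> can be computed on each closed cell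
  separately. Both continuity and differentiability are limits, and matching at the nodes
  makes each piece represent the function on its closed cell.
\<close>

section \<open>Limits along the half-line from limits on closed cells\<close>

definition closed_cell :: "real \<Rightarrow> nat \<Rightarrow> real set" where
  "closed_cell \<tau> n = {tnode \<tau> n .. tnode \<tau> (Suc n)}"

lemma closed_cell_cases:
  assumes "\<tau> > 0" and "t \<in> closed_cell \<tau> n"
  obtains "t \<in> J_cell \<tau> n" | "t = tnode \<tau> (Suc n)" and "t \<in> J_cell \<tau> (Suc n)"
  using assms by (force simp: closed_cell_def J_cell_def tnode_def)

text \<open>
  A point of cell \<open>n\<close> has a neighbourhood meeting only the cells \<open>n - 1\<close> and \<open>n\<close>. For
  \<open>n = 0\<close> truncated subtraction makes these two the same cell, which is harmless.
\<close>

lemma at_within_half_line: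
  assumes "\<tau> > 0" and t: "t \<in> J_cell \<tau> n"
  shows "at t within {0..} = at t within (closed_cell \<tau> (n - 1) \<union> closed_cell \<tau> n)"
proof (rule at_within_nhd)
  let ?U = "{(real n - 1) * \<tau> <..< (real n + 1) * \<tau>}"
  show "t \<in> ?U"
    using assms by (auto simp: J_cell_def tnode_def algebra_simps)
  show "open ?U"
    by simp
  show "{0..} \<inter> ?U - {t} = (closed_cell \<tau> (n - 1) \<union> closed_cell \<tau> n) \<inter> ?U - {t}"
  proof (cases n)
    case 0
    then show ?thesis
      using assms by (auto simp: closed_cell_def tnode_def)
  next
    case (Suc m)
    have "?U = {real m * \<tau> <..< tnode \<tau> (Suc n)}"
      by (simp add: Suc tnode_def algebra_simps)
    moreover have "closed_cell \<tau> (n - 1) \<union> closed_cell \<tau> n = {real m * \<tau> .. tnode \<tau> (Suc n)}"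
      using \<open>\<tau> > 0\<close> by (auto simp: Suc closed_cell_def tnode_def algebra_simps)
    moreover have "0 \<le> real m * \<tau>"
      using \<open>\<tau> > 0\<close> by simp
    ultimately show ?thesis
      by auto
  qed
qed

text \<open>
  Stated for an arbitrary limit \<open>l\<close> of an arbitrary \<open>g\<close>, so that it serves continuity (with
  \<open>g = f\<close>) and differentiability (with \<open>g\<close> the remainder quotient at \<open>t\<close>) alike.
\<close>

lemma tendsto_half_line:
  assumes "\<tau> > 0" and "t \<ge> 0"
    and lim: "\<And>n. t \<in> closed_cell \<tau> n \<Longrightarrow> (g \<longlongrightarrow> l) (at t within closed_cell \<tau> n)"
  shows "(g \<longlongrightarrow> l) (at t within {0..})"
proof -
  \<comment> \<open>Away from a closed cell the limit within that cell is a limit along the trivial filter.\<close>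
  have "(g \<longlongrightarrow> l) (at t within closed_cell \<tau> n)" for n
  proof (cases "t \<in> closed_cell \<tau> n")
    case False
    moreover have "closed (closed_cell \<tau> n)"
      by (simp add: closed_cell_def)
    ultimately have "at t within closed_cell \<tau> n = bot"
      by (metis closed_limpt trivial_limit_within)
    then show ?thesis
      by simp
  qed (rule lim)
  moreover obtain n where "t \<in> J_cell \<tau> n"
    using Union_J_cell[OF \<open>\<tau> > 0\<close>] \<open>t \<ge> 0\<close> by auto
  ultimately show ?thesis
    by (simp add: at_within_half_line[OF \<open>\<tau> > 0\<close>] Lim_Un)
qed

section \<open>Gluing smooth pieces\<close>

lemma piece_on_closed_cell:
  assumes "\<tau> > 0"
    and f: "\<And>n t. t \<in> J_cell \<tau> n \<Longrightarrow> f t = p n t"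
    and match: "\<And>n. p n (tnode \<tau> (Suc n)) = p (Suc n) (tnode \<tau> (Suc n))"
    and t: "t \<in> closed_cell \<tau> n"
  shows "f t = p n t"
  using closed_cell_cases[OF \<open>\<tau> > 0\<close> t] by cases (auto simp: f match)

lemma piecewise_continuous_on:
  fixes p :: "nat \<Rightarrow> real \<Rightarrow> 'a::real_normed_vector"
  assumes "\<tau> > 0"
    and f: "\<And>n t. t \<in> J_cell \<tau> n \<Longrightarrow> f t = p n t"
    and match: "\<And>n. p n (tnode \<tau> (Suc n)) = p (Suc n) (tnode \<tau> (Suc n))"
    and cont: "\<And>n. continuous_on (closed_cell \<tau> n) (p n)"
  shows "continuous_on {0..} f"
proof -
  have "continuous_on (closed_cell \<tau> n) f" for n
    using cont[of n] piece_on_closed_cell[of \<tau> f p, OF \<open>\<tau> > 0\<close> f match]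
    by (simp cong: continuous_on_cong)
  then show ?thesis
    by (auto simp: continuous_on_def intro: tendsto_half_line[OF \<open>\<tau> > 0\<close>])
qed

lemma piecewise_has_vector_derivative:
  fixes p :: "nat \<Rightarrow> real \<Rightarrow> 'a::real_normed_vector"
  assumes "\<tau> > 0" and "t \<ge> 0"
    and f: "\<And>n t. t \<in> J_cell \<tau> n \<Longrightarrow> f t = p n t"
    and match: "\<And>n. p n (tnode \<tau> (Suc n)) = p (Suc n) (tnode \<tau> (Suc n))"
    and f': "\<And>n t. t \<in> J_cell \<tau> n \<Longrightarrow> f' t = p' n t"
    and match': "\<And>n. p' n (tnode \<tau> (Suc n)) = p' (Suc n) (tnode \<tau> (Suc n))"
    and deriv: "\<And>n t. t \<in> closed_cell \<tau> n \<Longrightarrow>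
      (p n has_vector_derivative p' n t) (at t within closed_cell \<tau> n)"
  shows "(f has_vector_derivative f' t) (at t within {0..})"
proof -
  have "(f has_vector_derivative f' t) (at t within closed_cell \<tau> n)"
    if t: "t \<in> closed_cell \<tau> n" for n
  proof (rule has_vector_derivative_transform[OF t])
    show "f s = p n s" if "s \<in> closed_cell \<tau> n" for s
      using piece_on_closed_cell[of \<tau> f p, OF \<open>\<tau> > 0\<close> f match that] .
    show "(p n has_vector_derivative f' t) (at t within closed_cell \<tau> n)"
      using piece_on_closed_cell[of \<tau> f' p', OF \<open>\<tau> > 0\<close> f' match' t] deriv[OF t] by simp
  qed
  then show ?thesis
    unfolding has_vector_derivative_def has_derivative_within
    by (auto intro: bounded_linear_scaleR_left tendsto_half_line[OF \<open>\<tau> > 0\<close> \<open>t \<ge> 0\<close>])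
qed

text \<open>
  Here \<open>P j n\<close> is the \<open>j\<close>-th derivative of the piece on cell \<open>n\<close>. Gluing the
  first derivatives of the pieces gives the derivative of the glued function, to which the
  same statement with \<open>k\<close> lowered by one applies.
\<close>

lemma C_k_on_piecewise:
  fixes P :: "nat \<Rightarrow> nat \<Rightarrow> real \<Rightarrow> 'a::real_normed_vector"
  assumes "\<tau> > 0"
    and "\<And>n t. t \<in> J_cell \<tau> n \<Longrightarrow> f t = P 0 n t"
    and "\<And>j n. j \<le> k \<Longrightarrow> P j n (tnode \<tau> (Suc n)) = P j (Suc n) (tnode \<tau> (Suc n))"
    and "\<And>j n t. j < k \<Longrightarrow> t \<in> closed_cell \<tau> n \<Longrightarrow>
      (P j n has_vector_derivative P (Suc j) n t) (at t within closed_cell \<tau> n)"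
    and "\<And>n. continuous_on (closed_cell \<tau> n) (P k n)"
  shows "C_k_on k {0..} f"
  using assms(2-)
proof (induction k arbitrary: f P)
  case 0
  then show ?case
    using piecewise_continuous_on[of \<tau> f "P 0"] \<open>\<tau> > 0\<close> by simp
next
  case (Suc k)
  define f' where "f' t = P 1 (nat \<lfloor>t / \<tau>\<rfloor>) t" for t
  have f': "f' t = P 1 n t" if "t \<in> J_cell \<tau> n" for n t
    using that \<open>\<tau> > 0\<close> by (simp add: f'_def J_cell_iff_floor)
  have "(f has_vector_derivative f' t) (at t within {0..})" if "t \<in> {0..}" for t
  proof (rule piecewise_has_vector_derivative[of \<tau> t f "P 0" f' "P 1", OF \<open>\<tau> > 0\<close>])
    show "t \<ge> 0"
      using that by simp
  qed (use Suc.prems(1,2) Suc.prems(3)[of 0] f' in auto)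
  moreover have "C_k_on k {0..} f'"
  proof (rule Suc.IH[of f' "\<lambda>j. P (Suc j)"])
    show "f' t = P (Suc 0) n t" if "t \<in> J_cell \<tau> n" for n t
      using f'[OF that] by simp
  qed (use Suc.prems(2-4) in auto)
  ultimately show ?case
    by auto
qed

section \<open>Five-point stencils\<close>

text \<open>
  Recording the coefficients as weights of \<open>W\<^sup>n\<^sup>+\<^sup>2, \<dots>, W\<^sup>n\<^sup>-\<^sup>2\<close> turns vector identities into
  componentwise identities between real numbers.
\<close>

definition stencil ::
  "(nat \<Rightarrow> 'a::real_vector) \<Rightarrow> nat \<Rightarrow> real \<Rightarrow> real \<Rightarrow> real \<Rightarrow> real \<Rightarrow> real \<Rightarrow> 'a" where
  "stencil W n a b c d e =
     a *\<^sub>R zero_ext W (int n + 2) + b *\<^sub>R zero_ext W (int n + 1) + c *\<^sub>R zero_ext W (int n)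
     + d *\<^sub>R zero_ext W (int n - 1) + e *\<^sub>R zero_ext W (int n - 2)"

lemma stencil_add:
  "stencil W n a b c d e + stencil W n a' b' c' d' e' =
   stencil W n (a + a') (b + b') (c + c') (d + d') (e + e')"
  by (simp add: stencil_def algebra_simps)

lemma stencil_scaleR:
  "r *\<^sub>R stencil W n a b c d e = stencil W n (r * a) (r * b) (r * c) (r * d) (r * e)"
  by (simp add: stencil_def algebra_simps)

lemma stencil_shift: "stencil W n a b c d 0 = stencil W (Suc n) 0 a b c d"
  by (simp add: stencil_def algebra_simps)

lemma stencil_cong:
  "\<lbrakk>a = a'; b = b'; c = c'; d = d'; e = e'\<rbrakk>
    \<Longrightarrow> stencil W n a b c d e = stencil W n a' b' c' d' e'"
  by simp

text \<open>
  The common denominators stay outside the stencils, so that the outer weight remains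
  literally \<open>0\<close> and \<open>stencil_shift\<close> can be applied from right to left.
\<close>

lemma coeff_stencil:
  "coeff_alpha W n = stencil W n 0 3 17 5 (-1) /\<^sub>R 24"
  "coeff_beta \<tau> W n = stencil W n 0 5 3 (-9) 1 /\<^sub>R (12 * \<tau>)"
  "coeff_gamma \<tau> W n = stencil W n 0 1 (-2) 1 0 /\<^sub>R \<tau> ^ 2"
  "coeff_theta \<tau> W n = stencil W n 1 (-2) 0 2 (-1) /\<^sub>R (2 * \<tau> ^ 3)"
  "coeff_epsilon \<tau> W n = stencil W n 1 (-4) 6 (-4) 1 /\<^sub>R \<tau> ^ 4"
  by (simp_all add: coeff_alpha_def coeff_beta_def coeff_gamma_def coeff_theta_def
      coeff_epsilon_def stencil_def Let_def)

section \<open>Derivatives of the quartic pieces\<close>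

text \<open>
  The \<open>j\<close>-th derivative of the quartic on cell \<open>n\<close>, meaningful only for \<open>j \<le> 2\<close>; larger \<open>j\<close>
  repeat the second derivative as a default.
\<close>

definition lift_deriv ::
  "real \<Rightarrow> (nat \<Rightarrow> 'a::real_normed_vector) \<Rightarrow> nat \<Rightarrow> nat \<Rightarrow> real \<Rightarrow> 'a" where
  "lift_deriv \<tau> W j n = (\<lambda>t.
     let s = t - tnode \<tau> n in
      if j = 0 then lift_poly \<tau> W n t
      else if j = 1 then
        coeff_beta \<tau> W n + s *\<^sub>R coeff_gamma \<tau> W n + (s ^ 2 / 2) *\<^sub>R coeff_theta \<tau> W n
        + (s ^ 3 / 6) *\<^sub>R coeff_epsilon \<tau> W n
      else
        coeff_gamma \<tau> W n + s *\<^sub>R coeff_theta \<tau> W n + (s ^ 2 / 2) *\<^sub>R coeff_epsilon \<tau> W n)"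

lemma taylor_monomial_has_vector_derivative:
  fixes c :: "'a::real_normed_vector"
  shows "((\<lambda>t. ((t - a) ^ Suc m / fact (Suc m)) *\<^sub>R c) has_vector_derivative
    ((t - a) ^ m / fact m) *\<^sub>R c) (at t within S)"
proof -
  have "((\<lambda>t. (t - a) ^ Suc m) has_field_derivative real (Suc m) * (t - a) ^ m) (at t within S)"
    using DERIV_power[OF DERIV_diff[OF DERIV_ident DERIV_const[of a]], where n = "Suc m"] by simp
  from DERIV_cdivide[OF this, of "fact (Suc m)"]
  have "((\<lambda>t. (t - a) ^ Suc m / fact (Suc m)) has_field_derivative (t - a) ^ m / fact m)
      (at t within S)"
    by (simp only: fact_Suc) (simp del: of_nat_Suc)
  from has_vector_derivative_scaleR[OF this has_vector_derivative_const[of c]] show ?thesis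
    by simp
qed

lemma taylor_quartic_has_vector_derivative:
  fixes c\<^sub>0 c\<^sub>1 c\<^sub>2 c\<^sub>3 c\<^sub>4 :: "'a::real_normed_vector"
  shows "((\<lambda>t. c\<^sub>0 + (t - a) *\<^sub>R c\<^sub>1 + ((t - a) ^ 2 / 2) *\<^sub>R c\<^sub>2 + ((t - a) ^ 3 / 6) *\<^sub>R c\<^sub>3
      + ((t - a) ^ 4 / 24) *\<^sub>R c\<^sub>4) has_vector_derivative
    c\<^sub>1 + (t - a) *\<^sub>R c\<^sub>2 + ((t - a) ^ 2 / 2) *\<^sub>R c\<^sub>3 + ((t - a) ^ 3 / 6) *\<^sub>R c\<^sub>4) (at t within S)"
proof -
  note monomial = taylor_monomial_has_vector_derivative[where a = a and t = t and S = S]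
  have "((\<lambda>t. c\<^sub>0 + ((t - a) ^ Suc 0 / fact (Suc 0)) *\<^sub>R c\<^sub>1 + ((t - a) ^ Suc 1 / fact (Suc 1)) *\<^sub>R c\<^sub>2
      + ((t - a) ^ Suc 2 / fact (Suc 2)) *\<^sub>R c\<^sub>3 + ((t - a) ^ Suc 3 / fact (Suc 3)) *\<^sub>R c\<^sub>4)
    has_vector_derivative
      0 + ((t - a) ^ 0 / fact 0) *\<^sub>R c\<^sub>1 + ((t - a) ^ 1 / fact 1) *\<^sub>R c\<^sub>2
      + ((t - a) ^ 2 / fact 2) *\<^sub>R c\<^sub>3 + ((t - a) ^ 3 / fact 3) *\<^sub>R c\<^sub>4) (at t within S)"
    by (intro has_vector_derivative_add has_vector_derivative_const monomial)
  moreover have "fact (Suc 1) = (2::real)" "fact (Suc 2) = (6::real)" "fact (Suc 3) = (24::real)"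
      "fact 2 = (2::real)" "fact 3 = (6::real)"
    by (simp_all add: fact_numeral)
  moreover have "Suc 1 = 2" "Suc 2 = 3" "Suc 3 = 4"
    by simp_all
  ultimately show ?thesis
    by (simp only: fact_0 fact_1 power_0 power_Suc0_right power_one_right fact_Suc_0
        div_by_1 scaleR_one add_0_left One_nat_def)
qed

lemma lift_deriv_has_vector_derivative:
  assumes "j < 2"
  shows "(lift_deriv \<tau> W j n has_vector_derivative lift_deriv \<tau> W (Suc j) n t) (at t within S)"
proof -
  note quartic = taylor_quartic_has_vector_derivative[where a = "tnode \<tau> n" and t = t and S = S]
  consider "j = 0" | "j = 1"
    using assms by linarith
  then show ?thesis
  proof cases
    case 1
    then show ?thesis
      using quartic by (simp add: lift_deriv_def lift_poly_def Let_def)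
  next
    case 2
    then show ?thesis
      \<comment> \<open>The first derivative is a cubic, that is, a quartic without leading term.\<close>
      using quartic[where c\<^sub>4 = 0] by (simp add: lift_deriv_def Let_def)
  qed
qed

lemma continuous_on_lift_deriv: "continuous_on S (lift_deriv \<tau> W 2 n)"
  by (auto simp: lift_deriv_def Let_def intro!: continuous_intros)

text \<open>
  At the right end of cell \<open>n\<close> the weight of \<open>W\<^sup>n\<^sup>-\<^sup>2\<close> cancels in the derivatives of order up
  to two; shifting the remaining weights by one gives the constant Taylor term of cell
  \<open>n + 1\<close>.
\<close>

lemma lift_deriv_match:
  assumes "\<tau> > 0" and "j \<le> 2"
  shows "lift_deriv \<tau> W j n (tnode \<tau> (Suc n)) = lift_deriv \<tau> W j (Suc n) (tnode \<tau> (Suc n))"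
proof -
  have step: "tnode \<tau> (Suc n) - tnode \<tau> n = \<tau>"
    by (simp add: tnode_def algebra_simps)
  note power_eq = power2_eq_square power3_eq_cube power4_eq_xxxx
  \<comment> \<open>The shift, read from right to left, carries the coefficients of cell \<open>n + 1\<close> back to
    stencils at \<open>n\<close>, where both sides can be compared weight by weight.\<close>
  note to_weights = coeff_stencil stencil_scaleR stencil_add stencil_shift[symmetric]
  have value_end: "coeff_alpha W n + \<tau> *\<^sub>R coeff_beta \<tau> W n + (\<tau> ^ 2 / 2) *\<^sub>R coeff_gamma \<tau> W n
      + (\<tau> ^ 3 / 6) *\<^sub>R coeff_theta \<tau> W n + (\<tau> ^ 4 / 24) *\<^sub>R coeff_epsilon \<tau> W n
      = coeff_alpha W (Suc n)"
    unfolding to_weights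
    using \<open>\<tau> > 0\<close> by (intro stencil_cong) (simp_all add: power_eq field_simps)
  have slope_end: "coeff_beta \<tau> W n + \<tau> *\<^sub>R coeff_gamma \<tau> W n
      + (\<tau> ^ 2 / 2) *\<^sub>R coeff_theta \<tau> W n + (\<tau> ^ 3 / 6) *\<^sub>R coeff_epsilon \<tau> W n
      = coeff_beta \<tau> W (Suc n)"
    unfolding to_weights
    using \<open>\<tau> > 0\<close> by (intro stencil_cong) (simp_all add: power_eq field_simps)
  have second_end: "coeff_gamma \<tau> W n + \<tau> *\<^sub>R coeff_theta \<tau> W n
      + (\<tau> ^ 2 / 2) *\<^sub>R coeff_epsilon \<tau> W n = coeff_gamma \<tau> W (Suc n)"
    unfolding to_weights
    using \<open>\<tau> > 0\<close> by (intro stencil_cong) (simp_all add: power_eq field_simps)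
  consider "j = 0" | "j = 1" | "j = 2"
    using \<open>j \<le> 2\<close> by linarith
  then show ?thesis
    by cases (simp_all add: lift_deriv_def lift_poly_def Let_def step
        value_end slope_end second_end)
qed

section \<open>Regularity of the lifting\<close>

theorem lemma3p2:
  fixes W :: "nat \<Rightarrow> 'a::banach" and \<tau> :: real
  assumes "\<tau> > 0"
  shows "C_k_on 2 {0..} (lifting \<tau> W)"
proof (rule C_k_on_piecewise[where P = "lift_deriv \<tau> W", OF assms])
  show "lifting \<tau> W t = lift_deriv \<tau> W 0 n t" if "t \<in> J_cell \<tau> n" for n t
    using lifting_on_J_cell[OF assms that] by (simp add: lift_deriv_def)
qed (use assms in \<open>simp_all add: lift_deriv_match lift_deriv_has_vector_derivative
    continuous_on_lift_deriv\<close>)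

end
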